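(* Let $\mathbb F$ be a field and $\Lambda$ an infinite linearly ordered set, and let $M=M(\mathbb F,\Lambda)$ be the McLain group determined by $\Lambda$ and $\mathbb F$. Consider an arbitrary element $$u=1+a_{\alpha_1,\beta_1}e_{\alpha_1,\beta_1}+\ldots+a_{\alpha_m,\beta_m}e_{\alpha_m,\beta_m}$$ of $M$, with $\alpha_i<\beta_i$ in $\Lambda$ and $0\neq a_{\alpha_i,\beta_i}\in\mathbb F$ for $i=1,\ldots,m$, and $(\alpha_i,\beta_i)\neq(\alpha_j,\beta_j)$ if $i\neq j$. Then $u\in P(M)$ if and only if the interval $[\alpha_i,\beta_i]=\{c\in\Lambda:\alpha_i\leq c\leq\beta_i\}$ is infinite for every $i=1,\ldots,m$. In particular, $P(M)=M(\mathbb F,\Sigma)$, where $\Sigma$ is the poset having the same underlying set as $\Lambda$ but in which $\alpha<\beta$ if and only if $\alpha<\beta$ in $\Lambda$ and $[\alpha,\beta]$ is infinite.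
   Context: For a group $G$, the pseudocentre is $P(G)=\bigcap_{x\in G}C_G(x)^G$, where $C_G(x)$ is the centralizer of $x$ in $G$ and, for a subgroup $H\leq G$, $H^G$ is the normal closure of $H$ in $G$. For a field $\mathbb F$ and a partially ordered set $\Lambda$, let $V$ be an $\mathbb F$-vector space with basis $\{v_\lambda:\lambda\in\Lambda\}$; for $\lambda<\mu$ let $e_{\lambda,\mu}$ be the linear map with $v_\lambda\mapsto v_\mu$ and $v_\zeta\mapsto 0$ for $\zeta\neq\lambda$ (maps are composed so that $e_{\lambda,\mu}e_{\mu,\zeta}=e_{\lambda,\zeta}$). The McLain group is $M(\mathbb F,\Lambda)=\langle 1+ae_{\lambda,\mu}:\lambda<\mu,\ a\in\mathbb F\rangle$, a group of invertible linear maps of $V$. Every element of $M(\mathbb F,\Lambda)$ is of the form $1+\sum a_{\alpha,\beta}e_{\alpha,\beta}$ (a finite sum over pairs $\alpha<\beta$). *)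

theory Defs
  imports Complex_Main "HOL-Algebra.Generated_Groups" "HOL-Library.Poly_Mapping"
begin

section \<open>The pseudocentre of a group\<close>

definition centralizer :: "('a, 'b) monoid_scheme \<Rightarrow> 'a \<Rightarrow> 'a set" where
  "centralizer G x = {g \<in> carrier G. g \<otimes>\<^bsub>G\<^esub> x = x \<otimes>\<^bsub>G\<^esub> g}"

definition normal_closure :: "('a, 'b) monoid_scheme \<Rightarrow> 'a set \<Rightarrow> 'a set" where
  "normal_closure G H = \<Inter> {N. N \<lhd> G \<and> H \<subseteq> N}"

definition pseudocentre :: "('a, 'b) monoid_scheme \<Rightarrow> 'a set" where
  "pseudocentre G = (\<Inter>x\<in>carrier G. normal_closure G (centralizer G x))"


section \<open>The vector space with basis indexed by a set\<close>

text \<open>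
  The vector space over \<open>'f\<close> with a basis indexed by \<open>'l\<close> is realised as the type
  \<open>'l \<Rightarrow>\<^sub>0 'f\<close> of finitely supported functions; the basis vector of index \<open>l\<close> is the
  function that is 1 at \<open>l\<close> and 0 elsewhere.
\<close>

definition vscale :: "'f::field \<Rightarrow> ('l \<Rightarrow>\<^sub>0 'f) \<Rightarrow> ('l \<Rightarrow>\<^sub>0 'f)" where
  "vscale c x = Poly_Mapping.map ((*) c) x"

definition vbasis :: "'l \<Rightarrow> ('l \<Rightarrow>\<^sub>0 'f::field)" where
  "vbasis l = Poly_Mapping.single l 1"

lemma lookup_vscale [simp]: "Poly_Mapping.lookup (vscale c x) k = c * Poly_Mapping.lookup x k"
  by (simp add: vscale_def Poly_Mapping.map.rep_eq when_def)

lemma lookup_vbasis: "Poly_Mapping.lookup (vbasis l) k = (if k = l then 1 else 0)"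
  by (auto simp: vbasis_def lookup_single when_def)

lemma lookup_sum_pm: "Poly_Mapping.lookup (sum f A) k = (\<Sum>i\<in>A. Poly_Mapping.lookup (f i) k)"
  by (induction A rule: infinite_finite_induct) (auto simp: lookup_add)

interpretation V: vector_space "vscale :: 'f::field \<Rightarrow> ('l \<Rightarrow>\<^sub>0 'f) \<Rightarrow> ('l \<Rightarrow>\<^sub>0 'f)"
  by unfold_locales (auto intro!: poly_mapping_eqI simp: lookup_add algebra_simps)

lemma inj_vbasis: "inj (vbasis :: 'l \<Rightarrow> ('l \<Rightarrow>\<^sub>0 'f::field))"
  by (rule injI) (metis lookup_vbasis zero_neq_one)

lemma vbasis_expansion:
  "x = (\<Sum>l\<in>Poly_Mapping.keys x. vscale (Poly_Mapping.lookup x l) (vbasis l))"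
  by (rule poly_mapping_eqI)
    (auto simp: lookup_sum_pm lookup_vbasis in_keys_iff if_distrib cong: if_cong)

lemma span_vbasis: "V.span (range (vbasis :: 'l \<Rightarrow> ('l \<Rightarrow>\<^sub>0 'f::field))) = UNIV"
proof -
  have "x \<in> V.span (range vbasis)" for x :: "'l \<Rightarrow>\<^sub>0 'f"
    by (subst vbasis_expansion) (intro V.span_sum V.span_scale V.span_base, auto)
  then show ?thesis by auto
qed

lemma independent_vbasis: "V.independent (range (vbasis :: 'l \<Rightarrow> ('l \<Rightarrow>\<^sub>0 'f::field)))"
proof (unfold V.independent_explicit_module)
  show "\<forall>t u v. finite t \<longrightarrow> t \<subseteq> range vbasis \<longrightarrow>
    (\<Sum>v\<in>t. vscale (u v) v) = (0 :: 'l \<Rightarrow>\<^sub>0 'f) \<longrightarrow> v \<in> t \<longrightarrow> u v = 0"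
  proof (intro allI impI)
    fix t u and v :: "'l \<Rightarrow>\<^sub>0 'f"
    assume t: "finite t" "t \<subseteq> range vbasis" "(\<Sum>v\<in>t. vscale (u v) v) = 0" "v \<in> t"
    then obtain l where l: "v = vbasis l" by auto
    have "0 = (\<Sum>w\<in>t. u w * Poly_Mapping.lookup w l)"
      using arg_cong[OF t(3), of "\<lambda>x. Poly_Mapping.lookup x l"] by (simp add: lookup_sum_pm)
    also have "\<dots> = (\<Sum>w\<in>t. if w = v then u v else 0)"
    proof (intro sum.cong refl)
      fix w assume "w \<in> t"
      then obtain k where "w = vbasis k" using t(2) by auto
      then show "u w * Poly_Mapping.lookup w l = (if w = v then u v else 0)"
        using inj_vbasis[where ?'l = 'l and ?'f = 'f] by (auto simp: l lookup_vbasis inj_eq)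
    qed
    finally show "u v = 0" using t by simp
  qed
qed


section \<open>McLain groups\<close>

text \<open>
  Linear maps act on the right: \<open>f \<otimes> g\<close> is first \<open>f\<close>, then \<open>g\<close>, so that
  \<open>e\<^bsub>\<lambda>,\<mu>\<^esub> e\<^bsub>\<mu>,\<zeta>\<^esub> = e\<^bsub>\<lambda>,\<zeta>\<^esub>\<close>.
\<close>

definition GL :: "(('l \<Rightarrow>\<^sub>0 'f::field) \<Rightarrow> ('l \<Rightarrow>\<^sub>0 'f)) monoid" where
  "GL = \<lparr>carrier = {f. Vector_Spaces.linear vscale vscale f \<and> bij f},
         mult = (\<lambda>f g. g \<circ> f), one = id\<rparr>"

definition e_map :: "'l \<Rightarrow> 'l \<Rightarrow> ('l \<Rightarrow>\<^sub>0 'f::field) \<Rightarrow> ('l \<Rightarrow>\<^sub>0 'f)" where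
  "e_map l m x = vscale (Poly_Mapping.lookup x l) (vbasis m)"

lemma linear_e_map: "Vector_Spaces.linear vscale vscale (e_map l m)"
  by unfold_locales (auto intro!: poly_mapping_eqI simp: e_map_def lookup_add algebra_simps)

lemma e_map_vbasis: "e_map l m (vbasis k) = (if k = l then vbasis m else 0)"
  by (auto simp: e_map_def lookup_vbasis)

lemma e_map_compose: "e_map m z \<circ> e_map l m = e_map l z"
  by (auto simp: e_map_def lookup_vbasis)

text \<open>
  The poset is the type \<open>'l\<close> with the strict order \<open>lt\<close>. The order is a parameter, not the
  one of a type class, because two orders on the same underlying set are to be compared.
  The argument of type \<open>'f itself\<close> names the field.
\<close>

definition mclain_generators ::
    "('l \<Rightarrow> 'l \<Rightarrow> bool) \<Rightarrow> (('l \<Rightarrow>\<^sub>0 'f::field) \<Rightarrow> ('l \<Rightarrow>\<^sub>0 'f)) set" where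
  "mclain_generators lt = {\<lambda>x. x + vscale a (e_map l m x) | a l m. lt l m}"

definition McLain ::
    "'f::field itself \<Rightarrow> ('l \<Rightarrow> 'l \<Rightarrow> bool) \<Rightarrow> (('l \<Rightarrow>\<^sub>0 'f) \<Rightarrow> ('l \<Rightarrow>\<^sub>0 'f)) monoid" where
  "McLain F lt = GL\<lparr>carrier := generate GL (mclain_generators lt)\<rparr>"

lemma group_GL: "group (GL :: (('l \<Rightarrow>\<^sub>0 'f::field) \<Rightarrow> ('l \<Rightarrow>\<^sub>0 'f)) monoid)"
proof (rule groupI)
  fix f :: "('l \<Rightarrow>\<^sub>0 'f) \<Rightarrow> ('l \<Rightarrow>\<^sub>0 'f)"
  assume "f \<in> carrier GL"
  then have lin: "Vector_Spaces.linear vscale vscale f" and bij: "bij f" by (auto simp: GL_def)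
  interpret vector_space_pair "vscale :: 'f \<Rightarrow> ('l \<Rightarrow>\<^sub>0 'f) \<Rightarrow> _" "vscale :: 'f \<Rightarrow> ('l \<Rightarrow>\<^sub>0 'f) \<Rightarrow> _" ..
  obtain g where g: "Vector_Spaces.linear vscale vscale g" "g \<circ> f = id"
    using linear_injective_left_inverse[OF lin] bij by (auto simp: bij_def)
  have gf: "g (f x) = x" for x using g(2) by (simp add: fun_eq_iff)
  have "f (g y) = y" for y
    using bij gf by (metis bij_pointE)
  then have "bij g" using gf by (intro o_bij[where g = f]) (auto simp: fun_eq_iff)
  moreover have "f \<circ> g = id" using \<open>\<And>y. f (g y) = y\<close> by auto
  ultimately show "\<exists>g\<in>carrier GL. g \<otimes>\<^bsub>GL\<^esub> f = \<one>\<^bsub>GL\<^esub>"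
    using g by (intro bexI[of _ g]) (auto simp: GL_def)
qed (auto simp: GL_def bij_comp V.linear_id intro: Vector_Spaces.linear_compose)

lemma mclain_generators_GL:
  assumes "irreflp lt"
  shows "mclain_generators lt \<subseteq> carrier (GL :: (('l \<Rightarrow>\<^sub>0 'f::field) \<Rightarrow> ('l \<Rightarrow>\<^sub>0 'f)) monoid)"
proof
  fix f :: "('l \<Rightarrow>\<^sub>0 'f) \<Rightarrow> ('l \<Rightarrow>\<^sub>0 'f)"
  assume "f \<in> mclain_generators lt"
  then obtain a l m where f: "f = (\<lambda>x. x + vscale a (e_map l m x))" and "lt l m"
    by (auto simp: mclain_generators_def)
  then have "l \<noteq> m" using assms by (auto simp: irreflp_def)
  have "Vector_Spaces.linear vscale vscale f"
    unfolding f
    by unfold_locales (auto intro!: poly_mapping_eqI simp: e_map_def lookup_add algebra_simps)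
  moreover have "bij f"
    by (rule o_bij[where g = "\<lambda>x. x + vscale (- a) (e_map l m x)"])
      (use \<open>l \<noteq> m\<close> in \<open>auto intro!: poly_mapping_eqI
        simp: f fun_eq_iff e_map_def lookup_add lookup_minus lookup_vbasis algebra_simps\<close>)
  ultimately show "f \<in> carrier GL" by (simp add: GL_def)
qed

lemma group_McLain: "irreflp lt \<Longrightarrow> group (McLain TYPE('f::field) lt)"
  unfolding McLain_def
  by (intro group.subgroup_imp_group[OF group_GL] group.generate_is_subgroup[OF group_GL]
      mclain_generators_GL)

text \<open>The strict order of the poset \<open>\<Sigma>\<close> on the underlying set of a linear order.\<close>

definition inf_less :: "'l::linorder \<Rightarrow> 'l \<Rightarrow> bool" where
  "inf_less \<alpha> \<beta> \<longleftrightarrow> \<alpha> < \<beta> \<and> infinite {\<alpha>..\<beta>}"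

lemma irreflp_inf_less: "irreflp inf_less"
  by (simp add: irreflp_def inf_less_def)

lemma transp_inf_less: "transp inf_less"
proof (rule transpI)
  fix x y z :: 'a
  assume xy: "inf_less x y" and yz: "inf_less y z"
  then have "{x..y} \<subseteq> {x..z}" by (auto simp: inf_less_def)
  then show "inf_less x z"
    using xy yz unfolding inf_less_def by (meson finite_subset order.strict_trans)
qed

end

theory Submission
  imports Defs
begin

text \<open>
  The coefficients of \<open>g - 1\<close> on an interval \<open>[p,q]\<close> are multiplicative in \<open>g\<close>, since all elements
  are upper triangular. If \<open>[p,q]\<close> is finite, those \<open>g\<close> whose coefficients vanish on \<open>[p,q]\<close>
  therefore form a normal subgroup. Infinitely many indices lie above \<open>q\<close> or below \<open>p\<close>; say above.
  Choose an order-reversing map \<open>d\<close> from \<open>[p,q]\<close> to indices above \<open>q\<close>. An element commuting with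
  \<open>1 + \<Sum>\<^sub>c e\<^bsub>c,d(c)\<^esub>\<close> has equal coefficients at \<open>(c,c')\<close> and \<open>(d(c),d(c'))\<close>; for \<open>c < c'\<close> the
  latter is below the diagonal, so the centralizer lies in that normal subgroup.
  Conversely, if \<open>[\<alpha>,\<beta>]\<close> is infinite and \<open>x\<close> is given, pick \<open>\<alpha> < \<gamma> < \<delta> < \<beta>\<close> not occurring in
  \<open>x\<close>. Then \<open>1 + e\<^bsub>\<gamma>,\<delta>\<^esub>\<close> centralizes \<open>x\<close>, and commutators with \<open>1 + a e\<^bsub>\<alpha>,\<gamma>\<^esub>\<close> and
  \<open>1 + e\<^bsub>\<delta>,\<beta>\<^esub>\<close> turn it into \<open>1 + a e\<^bsub>\<alpha>,\<beta>\<^esub>\<close>.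
\<close>

section \<open>Matrix entries of linear maps\<close>

text \<open>This is an entry of the matrix of \<open>g - 1\<close>. Rows are indexed by the source,
  so that, with maps acting on the right, products in \<open>GL\<close> become matrix products in
  the same order.\<close>

definition coeff :: "(('l \<Rightarrow>\<^sub>0 'f::field) \<Rightarrow> ('l \<Rightarrow>\<^sub>0 'f)) \<Rightarrow> 'l \<Rightarrow> 'l \<Rightarrow> 'f" where
  "coeff g l m = Poly_Mapping.lookup (g (vbasis l)) m - (if m = l then 1 else 0)"

definition supp :: "(('l \<Rightarrow>\<^sub>0 'f::field) \<Rightarrow> ('l \<Rightarrow>\<^sub>0 'f)) \<Rightarrow> ('l \<times> 'l) set" where
  "supp g = {(l, m). coeff g l m \<noteq> 0}"

definition transv :: "'l \<Rightarrow> 'l \<Rightarrow> 'f::field \<Rightarrow> ('l \<Rightarrow>\<^sub>0 'f) \<Rightarrow> ('l \<Rightarrow>\<^sub>0 'f)" where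
  "transv l m a = (\<lambda>x. x + vscale a (e_map l m x))"

definition unip :: "('l \<times> 'l) set \<Rightarrow> ('l \<Rightarrow> 'l \<Rightarrow> 'f::field) \<Rightarrow> ('l \<Rightarrow>\<^sub>0 'f) \<Rightarrow> ('l \<Rightarrow>\<^sub>0 'f)" where
  "unip A a = (\<lambda>x. x + (\<Sum>p\<in>A. vscale (a (fst p) (snd p)) (e_map (fst p) (snd p) x)))"

lemma lookup_e_map: "Poly_Mapping.lookup (e_map l m x) k = (if k = m then Poly_Mapping.lookup x l else 0)"
  by (simp add: e_map_def lookup_vbasis)

lemma lookup_basis_image:
  "Poly_Mapping.lookup (g (vbasis l)) m = (if m = l then 1 else 0) + coeff g l m"
  by (simp add: coeff_def)

lemma linear_expansion:
  assumes "Vector_Spaces.linear vscale vscale f"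
  shows "f x = (\<Sum>l\<in>Poly_Mapping.keys x. vscale (Poly_Mapping.lookup x l) (f (vbasis l)))"
proof -
  interpret Vector_Spaces.linear vscale vscale f by fact
  show ?thesis by (subst vbasis_expansion) (simp add: sum scale)
qed

lemma lookup_linear:
  assumes "Vector_Spaces.linear vscale vscale f"
  shows "Poly_Mapping.lookup (f x) m = Poly_Mapping.lookup x m +
    (\<Sum>l\<in>Poly_Mapping.keys x. Poly_Mapping.lookup x l * coeff f l m)"
proof -
  have "Poly_Mapping.lookup (f x) m =
      (\<Sum>l\<in>Poly_Mapping.keys x. Poly_Mapping.lookup x l * ((if m = l then 1 else 0) + coeff f l m))"
    by (subst linear_expansion[OF assms]) (simp add: lookup_sum_pm lookup_basis_image)
  also have "\<dots> = (\<Sum>l\<in>Poly_Mapping.keys x. if m = l then Poly_Mapping.lookup x l else 0) +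
      (\<Sum>l\<in>Poly_Mapping.keys x. Poly_Mapping.lookup x l * coeff f l m)"
    by (subst sum.distrib[symmetric], rule sum.cong) (auto simp: distrib_left)
  finally show ?thesis by (simp add: in_keys_iff)
qed

lemma linear_eqI:
  assumes "Vector_Spaces.linear vscale vscale f" "Vector_Spaces.linear vscale vscale g"
    and "\<And>l m. coeff f l m = coeff g l m"
  shows "f = g"
  by (rule ext, rule poly_mapping_eqI) (simp add: lookup_linear assms)

text \<open>The identity (1+X)(1+Y) = 1+X+Y+XY, read at one entry. \<open>A\<close> may be any
  finite set that catches the nonzero terms of XY, so each use can choose the empty set, a singleton
  or an interval.\<close>

lemma coeff_comp:
  assumes lin: "Vector_Spaces.linear vscale vscale h"
    and A: "finite A" "\<And>k. coeff g l k \<noteq> 0 \<Longrightarrow> coeff h k m \<noteq> 0 \<Longrightarrow> k \<in> A"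
  shows "coeff (h \<circ> g) l m = coeff g l m + coeff h l m + (\<Sum>k\<in>A. coeff g l k * coeff h k m)"
proof -
  \<comment> \<open>Row \<open>l\<close> of \<open>g\<close> is finitely supported, so one finite
    set can carry all the sums; \<open>l\<close> is inserted to catch the diagonal 1.\<close>
  let ?K = "insert l (A \<union> Poly_Mapping.keys (g (vbasis l)))"
  have "(\<Sum>k\<in>Poly_Mapping.keys (g (vbasis l)). Poly_Mapping.lookup (g (vbasis l)) k * coeff h k m)
      = (\<Sum>k\<in>?K. Poly_Mapping.lookup (g (vbasis l)) k * coeff h k m)"
    using A(1) by (intro sum.mono_neutral_left) (auto simp: in_keys_iff)
  also have "\<dots> = (\<Sum>k\<in>?K. if k = l then coeff h l m else 0) + (\<Sum>k\<in>?K. coeff g l k * coeff h k m)"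
    by (subst sum.distrib[symmetric], rule sum.cong) (auto simp: lookup_basis_image distrib_right)
  also have "(\<Sum>k\<in>?K. if k = l then coeff h l m else 0) = coeff h l m"
    using A(1) by simp
  also have "(\<Sum>k\<in>?K. coeff g l k * coeff h k m) = (\<Sum>k\<in>A. coeff g l k * coeff h k m)"
    using A by (intro sum.mono_neutral_right) auto
  finally have *: "Poly_Mapping.lookup (h (g (vbasis l))) m = Poly_Mapping.lookup (g (vbasis l)) m
      + (coeff h l m + (\<Sum>k\<in>A. coeff g l k * coeff h k m))"
    by (subst lookup_linear[OF lin]) simp
  show ?thesis
    unfolding coeff_def[of "h \<circ> g"] o_apply * by (simp add: lookup_basis_image)
qed

lemma coeff_unip:
  assumes "finite A"
  shows "coeff (unip A a) l m = (if (l, m) \<in> A then a l m else 0)"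
proof -
  have "coeff (unip A a) l m = (\<Sum>p\<in>A. if p = (l, m) then a l m else 0)"
    by (auto simp: coeff_def unip_def lookup_add lookup_sum_pm lookup_e_map lookup_vbasis
        intro!: sum.cong split: if_splits)
  then show ?thesis using assms by simp
qed

lemma linear_unip: "Vector_Spaces.linear vscale vscale (unip A a)"
  by unfold_locales
    (auto intro!: poly_mapping_eqI sum.cong simp: unip_def lookup_add lookup_sum_pm lookup_e_map
      sum.distrib[symmetric] sum_distrib_left algebra_simps)

lemma unip_singleton: "unip {(l, m)} a = transv l m (a l m)"
  by (simp add: unip_def transv_def)

lemma linear_transv: "Vector_Spaces.linear vscale vscale (transv l m a)"
  using linear_unip[of "{(l, m)}" "\<lambda>_ _. a"] by (simp add: unip_singleton)

lemma coeff_transv: "coeff (transv l m a) j k = (if j = l \<and> k = m then a else 0)"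
  using coeff_unip[of "{(l, m)}" "\<lambda>_ _. a" j k] by (auto simp: unip_singleton)

lemma lookup_transv: "Poly_Mapping.lookup (transv l m a x) k =
    Poly_Mapping.lookup x k + (if k = m then a * Poly_Mapping.lookup x l else 0)"
  by (simp add: transv_def lookup_add lookup_e_map)

text \<open>Both products of \<open>g - 1\<close> with \<open>e_map l m\<close> vanish: one involves
  only row \<open>m\<close> of \<open>g - 1\<close>, the other only column \<open>l\<close>.\<close>

lemma transv_commute:
  assumes lin: "Vector_Spaces.linear vscale vscale g"
    and zero: "\<And>k. coeff g k l = 0" "\<And>k. coeff g m k = 0"
  shows "g \<circ> transv l m a = transv l m a \<circ> g"
proof (rule linear_eqI)
  fix j k
  have "coeff (g \<circ> transv l m a) j k =
      coeff (transv l m a) j k + coeff g j k + (\<Sum>i\<in>{}. coeff (transv l m a) j i * coeff g i k)"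
    by (rule coeff_comp[OF lin]) (simp_all add: coeff_transv zero split: if_splits)
  moreover have "coeff (transv l m a \<circ> g) j k =
      coeff g j k + coeff (transv l m a) j k + (\<Sum>i\<in>{}. coeff g j i * coeff (transv l m a) i k)"
    by (rule coeff_comp[OF linear_transv]) (simp_all add: coeff_transv zero split: if_splits)
  ultimately show "coeff (g \<circ> transv l m a) j k = coeff (transv l m a \<circ> g) j k"
    by simp
qed (rule Vector_Spaces.linear_compose[OF linear_transv lin]
    Vector_Spaces.linear_compose[OF lin linear_transv])+

text \<open>Steinberg's commutator relation for elementary matrices, with [g,h] = g h g^-1 h^-1; the
  composition is read from right to left.\<close>

lemma transv_commutator:
  assumes "l \<noteq> k" "k \<noteq> m" "l \<noteq> m"
  shows "transv k m (- b) \<circ> transv l k (- a) \<circ> transv k m b \<circ> transv l k a = transv l m (a * b)"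
  using assms
  by (auto simp: fun_eq_iff lookup_transv algebra_simps intro!: poly_mapping_eqI)

lemma transv_uminus: "l \<noteq> m \<Longrightarrow> transv l m (- a) \<circ> transv l m a = id"
  by (auto simp: fun_eq_iff lookup_transv algebra_simps intro!: poly_mapping_eqI)

section \<open>McLain groups described by supports\<close>

lemma mclain_generators_eq: "mclain_generators lt = {transv l m a | l m a. lt l m}"
  by (auto simp: mclain_generators_def transv_def)

lemma mult_GL [simp]: "f \<otimes>\<^bsub>GL\<^esub> g = g \<circ> f"
  by (simp add: GL_def)

lemma one_GL [simp]: "\<one>\<^bsub>GL\<^esub> = id"
  by (simp add: GL_def)

lemma mult_McLain [simp]: "f \<otimes>\<^bsub>McLain F lt\<^esub> g = g \<circ> f"
  by (simp add: McLain_def)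

lemma one_McLain [simp]: "\<one>\<^bsub>McLain F lt\<^esub> = id"
  by (simp add: McLain_def)

lemma coeff_id [simp]: "coeff id l m = 0"
  by (simp add: coeff_def lookup_vbasis)

lemma linear_GL: "g \<in> carrier GL \<Longrightarrow> Vector_Spaces.linear vscale vscale g"
  by (simp add: GL_def)

lemma carrier_McLain_subset_GL:
  "irreflp lt \<Longrightarrow> carrier (McLain TYPE('f::field) lt) \<subseteq> carrier GL"
  unfolding McLain_def
  using group.generate_incl[OF group_GL mclain_generators_GL] by simp

lemma transv_in_McLain: "lt l m \<Longrightarrow> transv l m a \<in> carrier (McLain F lt)"
  by (auto simp: McLain_def mclain_generators_eq intro: generate.incl)

lemma inv_transv_GL:
  assumes "l \<noteq> m"
  shows "inv\<^bsub>GL\<^esub> transv l m a = transv l m (- a)"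
proof -
  have "transv l m b \<in> carrier GL" for b :: 'b
  proof -
    have "transv l m b \<circ> transv l m (- b) = id"
      using transv_uminus[OF assms, of "- b"] by simp
    then have "bij (transv l m b)" by (intro o_bij[OF transv_uminus[OF assms]])
    then show ?thesis by (simp add: GL_def linear_transv)
  qed
  then show ?thesis
    using transv_uminus[OF assms, of "- a"] by (intro group.inv_equality[OF group_GL]) simp_all
qed

text \<open>By X+Y+XY, the support of a product lies in the two supports together with their
  relational composition. This keeps it finite, and transitivity keeps it inside
  \<open>lt\<close>.\<close>

lemma McLain_supp:
  assumes lt: "irreflp lt" "transp lt" and g: "g \<in> carrier (McLain TYPE('f::field) lt)"
  shows "finite (supp g) \<and> supp g \<subseteq> {(l, m). lt l m}"
proof -
  have gen: "supp (transv l m a) \<subseteq> {(l, m)}" for l m and a :: 'f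
    by (auto simp: supp_def coeff_transv split: if_splits)
  from g have "g \<in> generate GL (mclain_generators lt)" by (simp add: McLain_def)
  then show ?thesis
  proof induction
    case one
    then show ?case by (simp add: supp_def del: id_apply)
  next
    case (incl h)
    then obtain l m a where "h = transv l m a" "lt l m" by (auto simp: mclain_generators_eq)
    then show ?case using gen[of l m a] by (auto intro: finite_subset)
  next
    case (inv h)
    then obtain l m a where h: "h = transv l m a" "lt l m" by (auto simp: mclain_generators_eq)
    then have "l \<noteq> m" using lt by (auto simp: irreflp_def)
    then show ?case using gen[of l m "- a"] h by (auto simp: inv_transv_GL intro: finite_subset)
  next
    case (eng g h)
    have "h \<in> carrier GL"
      using group.generate_incl[OF group_GL mclain_generators_GL[OF lt(1)]] eng(2) by blast
    then have lin: "Vector_Spaces.linear vscale vscale h" by (rule linear_GL)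
    have "supp (h \<circ> g) \<subseteq> supp g \<union> supp h \<union> supp g O supp h"
    proof clarify
      fix l m
      assume lm: "(l, m) \<in> supp (h \<circ> g)" "(l, m) \<notin> supp h" "(l, m) \<notin> supp g O supp h"
      then have "coeff g l k = 0 \<or> coeff h k m = 0" for k
        by (auto simp: supp_def)
      then show "(l, m) \<in> supp g"
        using lm(1,2) coeff_comp[OF lin, of "{}" g l m] by (simp add: supp_def) metis
    qed
    moreover have "finite (supp g \<union> supp h \<union> supp g O supp h)"
      using eng by (auto intro: finite_relcomp)
    moreover have "supp g O supp h \<subseteq> {(l, m). lt l m}"
      using eng lt(2) by (auto dest: transpD)
    ultimately have "finite (supp (h \<circ> g)) \<and> supp (h \<circ> g) \<subseteq> {(l, m). lt l m}"
      using eng(3,4) by (intro conjI) (rule finite_subset, assumption+, blast)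
    then show ?case by (simp only: mult_GL)
  qed
qed

text \<open>
  Peeling off the entry with the largest column index \<open>m\<close> works because then row \<open>m\<close> vanishes.
\<close>

lemma unip_in_McLain:
  fixes lt :: "'l::linorder \<Rightarrow> 'l \<Rightarrow> bool"
  assumes "finite A" "A \<subseteq> {(l, m). lt l m}" and lt: "\<And>l m. lt l m \<Longrightarrow> l < m"
  shows "unip A a \<in> carrier (McLain F lt)"
  using assms(1,2)
proof (induction "card A" arbitrary: A)
  case 0
  then show ?case by (simp add: unip_def McLain_def id_def[symmetric] generate.one[of GL, simplified])
next
  case (Suc n)
  then have "Max (snd ` A) \<in> snd ` A" by (intro Max_in) auto
  then obtain p where p: "p \<in> A" "snd p = Max (snd ` A)" by force
  obtain l m where lm: "p = (l, m)" by force
  have max: "k \<le> m" if "(j, k) \<in> A" for j k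
  proof -
    have "k \<in> snd ` A" using that by force
    then show ?thesis using Suc(3) p(2) by (simp add: lm)
  qed
  let ?B = "A - {p}"
  have neq: "fst q \<noteq> m" if "q \<in> A" for q
    using that Suc(4) max[of "fst q" "snd q"] lt[of "fst q" "snd q"] by fastforce
  \<comment> \<open>\<open>transv l m (a l m)\<close> alters only coordinate \<open>m\<close>, which
    none of the remaining terms reads.\<close>
  have "unip ?B a (transv l m (a l m) x) = unip A a x" for x
  proof -
    have "e_map (fst q) (snd q) (transv l m (a l m) x) = e_map (fst q) (snd q) x" if "q \<in> A" for q
      using neq[OF that] by (auto intro!: poly_mapping_eqI simp: lookup_e_map transv_def lookup_add)
    then show ?thesis
      by (simp add: unip_def sum.remove[OF Suc(3) p(1)] lm transv_def add.assoc)
  qed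
  then have "unip A a = transv l m (a l m) \<otimes>\<^bsub>GL\<^esub> unip ?B a" by (simp add: fun_eq_iff)
  moreover have "unip ?B a \<in> carrier (McLain F lt)"
    using Suc p by (intro Suc(1)) auto
  moreover have "transv l m (a l m) \<in> carrier (McLain F lt)"
    using p Suc(4) by (intro transv_in_McLain) (auto simp: lm)
  ultimately show ?case by (simp add: McLain_def generate.eng del: mult_GL)
qed

text \<open>A linear map with finite support is \<open>unip\<close> of its own support and
  coefficients, so membership becomes a condition on the support. Any transitive relation inside the
  linear order is allowed, to cover both \<open><\<close> and \<open>inf_less\<close>.\<close>

lemma McLain_iff_supp:
  fixes lt :: "'l::linorder \<Rightarrow> 'l \<Rightarrow> bool"
  assumes "transp lt" and lt: "\<And>l m. lt l m \<Longrightarrow> l < m"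
  shows "g \<in> carrier (McLain TYPE('f::field) lt) \<longleftrightarrow>
    Vector_Spaces.linear vscale vscale g \<and> finite (supp g) \<and> supp g \<subseteq> {(l, m). lt l m}"
proof -
  have irr: "irreflp lt" using lt by (auto simp: irreflp_def)
  show ?thesis
  proof (intro iffI)
    assume g: "g \<in> carrier (McLain TYPE('f) lt)"
    then show "Vector_Spaces.linear vscale vscale g \<and> finite (supp g) \<and> supp g \<subseteq> {(l, m). lt l m}"
      using McLain_supp[OF irr assms(1) g] carrier_McLain_subset_GL[OF irr] linear_GL by blast
  next
    assume g: "Vector_Spaces.linear vscale vscale g \<and> finite (supp g) \<and> supp g \<subseteq> {(l, m). lt l m}"
    then have "g = unip (supp g) (coeff g)"
      by (intro linear_eqI) (auto simp: linear_unip coeff_unip supp_def)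
    then show "g \<in> carrier (McLain TYPE('f) lt)"
      using unip_in_McLain[of "supp g" lt "coeff g"] g lt by auto
  qed
qed

lemma McLain_inf_less_iff:
  "g \<in> carrier (McLain TYPE('f::field) (inf_less :: 'l::linorder \<Rightarrow> 'l \<Rightarrow> bool)) \<longleftrightarrow>
    Vector_Spaces.linear vscale vscale g \<and> finite (supp g) \<and> supp g \<subseteq> {(l, m). inf_less l m}"
  by (rule McLain_iff_supp[OF transp_inf_less]) (simp add: inf_less_def)

section \<open>The McLain group of \<open>inf_less\<close> lies in the pseudocentre\<close>

text \<open>A commutator with \<open>h\<close> is the product of one of \<open>h\<close>,
  \<open>inv h\<close> and a conjugate of the other. Both orders are given because the factor known
  to lie in \<open>N\<close> may stand on either side.\<close>

lemma (in group) commutator_in_normal: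
  assumes "N \<lhd> G" "g \<in> carrier G" "h \<in> N"
  shows "g \<otimes> h \<otimes> inv g \<otimes> inv h \<in> N" "h \<otimes> g \<otimes> inv h \<otimes> inv g \<in> N"
proof -
  interpret normal N G by fact
  have h: "h \<in> carrier G" using assms mem_carrier by blast
  show "g \<otimes> h \<otimes> inv g \<otimes> inv h \<in> N"
    using assms by (intro m_closed inv_op_closed2 m_inv_closed)
  have "h \<otimes> (g \<otimes> inv h \<otimes> inv g) \<in> N"
    using assms by (intro m_closed inv_op_closed2 m_inv_closed)
  then show "h \<otimes> g \<otimes> inv h \<otimes> inv g \<in> N"
    using assms h by (simp add: m_assoc)
qed

lemma inv_transv_McLain:
  assumes "irreflp lt" "lt l m"
  shows "inv\<^bsub>McLain TYPE('f::field) lt\<^esub> transv l m (a :: 'f) = transv l m (- a)"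
proof -
  have "l \<noteq> m" using assms by (auto simp: irreflp_def)
  then show ?thesis
    using transv_uminus[of l m "- a"] assms
    by (intro group.inv_equality[OF group_McLain]) (auto intro: transv_in_McLain)
qed

text \<open>The element is the commutator of the two transvections. Thus a transvection in a normal
  subgroup can be moved away from the diagonal at either end.\<close>

lemma transv_in_normal:
  fixes l k m :: "'l::linorder"
  assumes N: "N \<lhd> McLain TYPE('f::field) ((<) :: 'l \<Rightarrow> 'l \<Rightarrow> bool)" and "l < k" "k < m"
    and "transv l k a \<in> N \<or> transv k m (b :: 'f) \<in> N"
  shows "transv l m (a * b) \<in> N"
proof -
  let ?M = "McLain TYPE('f) ((<) :: 'l \<Rightarrow> 'l \<Rightarrow> bool)"
  have irr: "irreflp ((<) :: 'l \<Rightarrow> 'l \<Rightarrow> bool)" by simp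
  have eq: "transv l m (a * b) = transv l k a \<otimes>\<^bsub>?M\<^esub> transv k m b
      \<otimes>\<^bsub>?M\<^esub> inv\<^bsub>?M\<^esub> transv l k a \<otimes>\<^bsub>?M\<^esub> inv\<^bsub>?M\<^esub> transv k m b"
    using assms(2,3) transv_commutator[of l k m b a]
    by (simp add: inv_transv_McLain[OF irr] o_assoc)
  show ?thesis
    unfolding eq using assms(4)
  proof
    assume "transv l k a \<in> N"
    then show "transv l k a \<otimes>\<^bsub>?M\<^esub> transv k m b \<otimes>\<^bsub>?M\<^esub> inv\<^bsub>?M\<^esub> transv l k a
        \<otimes>\<^bsub>?M\<^esub> inv\<^bsub>?M\<^esub> transv k m b \<in> N"
      using assms(3) by (intro group.commutator_in_normal[OF group_McLain[OF irr] N] transv_in_McLain)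
  next
    assume "transv k m b \<in> N"
    then show "transv l k a \<otimes>\<^bsub>?M\<^esub> transv k m b \<otimes>\<^bsub>?M\<^esub> inv\<^bsub>?M\<^esub> transv l k a
        \<otimes>\<^bsub>?M\<^esub> inv\<^bsub>?M\<^esub> transv k m b \<in> N"
      using assms(2) by (intro group.commutator_in_normal[OF group_McLain[OF irr] N] transv_in_McLain)
  qed
qed

text \<open>An infinite interval stays infinite after its endpoints and \<open>S\<close> are
  discarded, and two distinct remaining points can be put in order.\<close>

lemma ex_two_between:
  fixes l m :: "'l::linorder"
  assumes "infinite {l..m}" "finite S"
  obtains c d where "l < c" "c < d" "d < m" "c \<notin> S" "d \<notin> S"
proof -
  define D where "D = {l..m} - insert l (insert m S)"
  have inf: "infinite D"
    unfolding D_def using assms by (intro Diff_infinite_finite) simp_all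
  have between: "l < i" "i < m" "i \<notin> S" if "i \<in> D" for i
    using that by (auto simp: D_def)
  obtain j where j: "j \<in> D"
    using infinite_imp_nonempty[OF inf] by (auto simp only: ex_in_conv[symmetric])
  have "infinite (D - {j})" using inf by simp
  then obtain k where k: "k \<in> D" "k \<noteq> j"
    using infinite_imp_nonempty[of "D - {j}"] by (auto simp only: ex_in_conv[symmetric])
  from k(2) show ?thesis
    using that[of j k] that[of k j] between[OF j] between[OF k(1)] by (auto simp only: neq_iff)
qed

lemma coeff_eq_0_row: "l \<notin> fst ` supp g \<Longrightarrow> coeff g l m = 0"
  by (force simp: supp_def)

lemma coeff_eq_0_col: "m \<notin> snd ` supp g \<Longrightarrow> coeff g l m = 0"
  by (force simp: supp_def)

lemma transv_in_centralizer:
  fixes l m :: "'l::linorder"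
  assumes x: "x \<in> carrier (McLain TYPE('f::field) ((<) :: 'l \<Rightarrow> 'l \<Rightarrow> bool))"
    and "l < m" "l \<notin> snd ` supp x" "m \<notin> fst ` supp x"
  shows "transv l m a \<in> centralizer (McLain TYPE('f) ((<) :: 'l \<Rightarrow> 'l \<Rightarrow> bool)) x"
proof -
  have "Vector_Spaces.linear vscale vscale x" using x by (simp add: McLain_iff_supp)
  then have "x \<circ> transv l m a = transv l m a \<circ> x"
    by (rule transv_commute) (simp_all add: assms coeff_eq_0_row coeff_eq_0_col)
  then show ?thesis
    using assms(2) by (simp add: centralizer_def transv_in_McLain)
qed

lemma ex_transv_in_centralizer:
  fixes l m :: "'l::linorder"
  assumes lm: "inf_less l m"
    and x: "x \<in> carrier (McLain TYPE('f::field) ((<) :: 'l \<Rightarrow> 'l \<Rightarrow> bool))"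
  obtains c d where "l < c" "c < d" "d < m"
    "transv c d 1 \<in> centralizer (McLain TYPE('f) ((<) :: 'l \<Rightarrow> 'l \<Rightarrow> bool)) x"
proof -
  let ?S = "fst ` supp x \<union> snd ` supp x"
  have "infinite {l..m}" "finite ?S"
    using lm x by (simp_all add: inf_less_def McLain_iff_supp)
  then obtain c d where cd: "l < c" "c < d" "d < m" and "c \<notin> ?S" "d \<notin> ?S"
    by (rule ex_two_between)
  then have "transv c d 1 \<in> centralizer (McLain TYPE('f) ((<) :: 'l \<Rightarrow> 'l \<Rightarrow> bool)) x"
    by (intro transv_in_centralizer[OF x]) auto
  then show ?thesis by (rule that[OF cd])
qed

lemma transv_in_normal_of_between:
  fixes l c d m :: "'l::linorder"
  assumes N: "N \<lhd> McLain TYPE('f::field) ((<) :: 'l \<Rightarrow> 'l \<Rightarrow> bool)"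
    and cd: "l < c" "c < d" "d < m" "transv c d 1 \<in> N"
  shows "transv l m a \<in> N"
  \<comment> \<open>The second fact acts first: it moves from (c,d) to (l,d) and brings in the
    coefficient \<open>a\<close>. The first fact then moves from (l,d) to (l,m).\<close>
  using transv_in_normal[OF N less_trans[OF cd(1,2)] cd(3), of "a * 1" 1]
    transv_in_normal[OF N cd(1,2), of a 1] cd(4)
  by simp

text \<open>This lets the inclusion of a generated group be checked on generators. \<open>G\<close>
  itself, as a normal subgroup, makes the families being intersected nonempty.\<close>

lemma (in group) subgroup_pseudocentre: "subgroup (pseudocentre G) G"
proof -
  have sub: "subgroup (normal_closure G H) G" if "H \<subseteq> carrier G" for H
    unfolding normal_closure_def using that normal_self
    by (intro subgroups_Inter) (auto intro: normal_imp_subgroup)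
  show ?thesis
    unfolding pseudocentre_def
    by (intro subgroups_Inter) (auto simp: centralizer_def intro!: sub)
qed

lemma McLain_inf_less_subset_pseudocentre:
  "carrier (McLain TYPE('f::field) (inf_less :: 'l::linorder \<Rightarrow> 'l \<Rightarrow> bool)) \<subseteq>
    pseudocentre (McLain TYPE('f) ((<) :: 'l \<Rightarrow> 'l \<Rightarrow> bool))"
proof -
  let ?M = "McLain TYPE('f) ((<) :: 'l \<Rightarrow> 'l \<Rightarrow> bool)"
  have irr: "irreflp ((<) :: 'l \<Rightarrow> 'l \<Rightarrow> bool)" by simp
  have "subgroup (pseudocentre ?M) GL"
    using group.generate_is_subgroup[OF group_GL mclain_generators_GL[OF irr]]
      group.subgroup_pseudocentre[OF group_McLain[OF irr]]
    unfolding McLain_def by (rule group.incl_subgroup[OF group_GL])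
  moreover have "mclain_generators inf_less \<subseteq> pseudocentre ?M"
    unfolding pseudocentre_def normal_closure_def
  proof (intro subsetI INT_I InterI, elim CollectE conjE)
    fix t x :: "('l \<Rightarrow>\<^sub>0 'f) \<Rightarrow> ('l \<Rightarrow>\<^sub>0 'f)" and N
    assume t: "t \<in> mclain_generators inf_less" and x: "x \<in> carrier ?M"
      and N: "N \<lhd> ?M" "centralizer ?M x \<subseteq> N"
    obtain l m a where lm: "t = transv l m a" "inf_less l m"
      using t by (auto simp only: mclain_generators_eq)
    show "t \<in> N"
      unfolding lm(1)
      by (rule ex_transv_in_centralizer[OF lm(2) x])
        (rule transv_in_normal_of_between[OF N(1) _ _ _ subsetD[OF N(2)]])
  qed
  ultimately have "generate GL (mclain_generators inf_less) \<subseteq> pseudocentre ?M"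
    by (intro group.generate_subgroup_incl[OF group_GL])
  then show ?thesis by (simp add: McLain_def)
qed

section \<open>Normal subgroups attached to finite intervals\<close>

lemma McLain_coeff_less:
  fixes l m :: "'l::linorder"
  assumes "g \<in> carrier (McLain TYPE('f::field) ((<) :: 'l \<Rightarrow> 'l \<Rightarrow> bool))" "coeff g l m \<noteq> 0"
  shows "l < m"
  using assms by (auto simp: McLain_iff_supp supp_def)

text \<open>A nonzero term forces l < k < m, so \<open>k\<close> stays in the interval. Hence, for
  \<open>l\<close> and \<open>m\<close> in the interval, the entry of a product depends only on
  entries of the factors in the same block.\<close>

lemma McLain_coeff_mult:
  fixes l m :: "'l::linorder"
  assumes g: "g \<in> carrier (McLain TYPE('f::field) ((<) :: 'l \<Rightarrow> 'l \<Rightarrow> bool))"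
    and h: "h \<in> carrier (McLain TYPE('f::field) ((<) :: 'l \<Rightarrow> 'l \<Rightarrow> bool))"
    and fin: "finite {p..q}" and "p \<le> l" "m \<le> q"
  shows "coeff (h \<circ> g) l m = coeff g l m + coeff h l m + (\<Sum>k\<in>{p..q}. coeff g l k * coeff h k m)"
proof (rule coeff_comp[OF _ fin])
  show "Vector_Spaces.linear vscale vscale h" using h by (simp add: McLain_iff_supp)
  show "k \<in> {p..q}" if "coeff g l k \<noteq> 0" "coeff h k m \<noteq> 0" for k
    using McLain_coeff_less[OF g that(1)] McLain_coeff_less[OF h that(2)] assms by auto
qed

text \<open>Equality under \<phi> is a congruence, and the class of the identity under a congruence
  is normal. This form spares a group structure on the values of \<phi>.\<close>

lemma (in group) normal_fibre_one:
  assumes cong: "\<And>g g' h h'. g \<in> carrier G \<Longrightarrow> g' \<in> carrier G \<Longrightarrow> h \<in> carrier G \<Longrightarrow> h' \<in> carrier G \<Longrightarrow>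
      \<phi> g = \<phi> g' \<Longrightarrow> \<phi> h = \<phi> h' \<Longrightarrow> \<phi> (g \<otimes> h) = \<phi> (g' \<otimes> h')"
  shows "{g \<in> carrier G. \<phi> g = \<phi> \<one>} \<lhd> G"
proof -
  have "\<phi> (inv n) = \<phi> \<one>" if "n \<in> carrier G" "\<phi> n = \<phi> \<one>" for n
    using cong[of "inv n" "inv n" \<one> n] that by simp
  moreover have "\<phi> (g \<otimes> h) = \<phi> \<one>"
    if "g \<in> carrier G" "h \<in> carrier G" "\<phi> g = \<phi> \<one>" "\<phi> h = \<phi> \<one>" for g h
    using cong[of g \<one> h \<one>] that by simp
  moreover have "\<phi> (x \<otimes> n \<otimes> inv x) = \<phi> \<one>" if "x \<in> carrier G" "n \<in> carrier G" "\<phi> n = \<phi> \<one>" for x n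
    using cong[of "x \<otimes> n" x "inv x" "inv x"] cong[of x x n \<one>] that by simp
  ultimately show ?thesis
    by (simp add: normal_inv_iff subgroup_def subset_iff)
qed

lemma normal_block_kernel:
  fixes p q :: "'l::linorder"
  assumes fin: "finite {p..q}"
  shows "{g \<in> carrier (McLain TYPE('f::field) ((<) :: 'l \<Rightarrow> 'l \<Rightarrow> bool)).
      \<forall>l\<in>{p..q}. \<forall>m\<in>{p..q}. coeff g l m = 0} \<lhd> McLain TYPE('f) ((<) :: 'l \<Rightarrow> 'l \<Rightarrow> bool)"
proof -
  let ?M = "McLain TYPE('f) ((<) :: 'l \<Rightarrow> 'l \<Rightarrow> bool)"
  \<comment> \<open>Off the block the restricted functions are \<open>undefined\<close>, so equality
    under \<phi> means equality of the entries inside the block.\<close>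
  define \<phi> where "\<phi> g = (\<lambda>l\<in>{p..q}. \<lambda>m\<in>{p..q}. coeff g l m)" for g :: "('l \<Rightarrow>\<^sub>0 'f) \<Rightarrow> ('l \<Rightarrow>\<^sub>0 'f)"
  have eq_iff: "\<phi> g = \<phi> h \<longleftrightarrow> (\<forall>l\<in>{p..q}. \<forall>m\<in>{p..q}. coeff g l m = coeff h l m)" for g h
    unfolding \<phi>_def by (auto simp only: restrict_def fun_eq_iff split: if_splits)
  have "{g \<in> carrier ?M. \<phi> g = \<phi> \<one>\<^bsub>?M\<^esub>} \<lhd> ?M"
  proof (rule group.normal_fibre_one[OF group_McLain])
    fix g g' h h'
    assume M: "g \<in> carrier ?M" "g' \<in> carrier ?M" "h \<in> carrier ?M" "h' \<in> carrier ?M"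
      and "\<phi> g = \<phi> g'" "\<phi> h = \<phi> h'"
    then have eq: "coeff g l m = coeff g' l m" "coeff h l m = coeff h' l m"
      if "l \<in> {p..q}" "m \<in> {p..q}" for l m
      using that by (simp_all only: eq_iff)
    have "coeff (h \<circ> g) l m = coeff (h' \<circ> g') l m" if lm: "l \<in> {p..q}" "m \<in> {p..q}" for l m
    proof -
      have "p \<le> l" "m \<le> q" using lm by simp_all
      then show ?thesis
        using lm by (simp only: McLain_coeff_mult[OF M(1,3) fin] McLain_coeff_mult[OF M(2,4) fin]
            eq cong: sum.cong)
    qed
    then show "\<phi> (g \<otimes>\<^bsub>?M\<^esub> h) = \<phi> (g' \<otimes>\<^bsub>?M\<^esub> h')"
      unfolding eq_iff mult_McLain by blast
  qed simp
  then show ?thesis by (simp only: eq_iff one_McLain coeff_id)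
qed

section \<open>Centralizers whose entries vanish on a finite interval\<close>

text \<open>Finite chains of equal size are anti-isomorphic: send the greatest element of
  \<open>I\<close> to the least of the target and use induction on the rest. The target is a subset
  of \<open>D\<close> of size \<open>card I\<close>.\<close>

lemma ex_strict_antimono:
  fixes I D :: "'l::linorder set"
  assumes "finite I" "infinite D"
  obtains d where "strict_antimono_on I d" "d ` I \<subseteq> D"
proof -
  have "\<exists>d. strict_antimono_on I d \<and> d ` I \<subseteq> E" if "finite E" "card E = card I" for E :: "'l set"
    using assms(1) that
  proof (induction I arbitrary: E rule: finite_linorder_max_induct)
    case empty
    then show ?case by (simp add: monotone_on_def)
  next
    case (insert b A)
    then have b: "b \<notin> A" by blast
    have card: "card E = Suc (card A)" using insert.prems(2) insert.hyps(1) b by simp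
    then have ne: "E \<noteq> {}" by force
    then have "card (E - {Min E}) = card A" using insert.prems(1) card by simp
    then obtain d where d: "strict_antimono_on A d" "d ` A \<subseteq> E - {Min E}"
      using insert by (metis finite_Diff)
    have less: "Min E < d a" if "a \<in> A" for a
    proof -
      have "d a \<in> E" "d a \<noteq> Min E" using d(2) that by auto
      then show ?thesis using insert.prems(1) by (simp add: order_less_le)
    qed
    have "strict_antimono_on (insert b A) (d(b := Min E))"
      using d(1) less b insert(2) by (auto simp: monotone_on_def dest: less_asym)
    moreover have "(d(b := Min E)) ` insert b A \<subseteq> E"
      using d(2) b Min_in[OF insert.prems(1) ne] by auto
    ultimately show ?case by blast
  qed
  moreover obtain E where "finite E" "card E = card I" "E \<subseteq> D"
    using infinite_arbitrarily_large[OF assms(2)] by blast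
  ultimately show ?thesis using that by (metis subset_trans)
qed

text \<open>
  Comparing the entries at \<open>(s i, t j)\<close> of the two products.
\<close>

lemma coeff_eq_of_commute:
  fixes s t :: "'i \<Rightarrow> 'l"
  assumes "finite I" and inj: "inj_on s I" "inj_on t I"
    and g: "Vector_Spaces.linear vscale vscale g"
  defines "x \<equiv> unip ((\<lambda>i. (s i, t i)) ` I) (\<lambda>_ _. 1 :: 'f::field)"
  assumes comm: "g \<circ> x = x \<circ> g" and ij: "i \<in> I" "j \<in> I"
  shows "coeff g (s i) (s j) = coeff g (t i) (t j)"
proof -
  let ?A = "(\<lambda>i. (s i, t i)) ` I"
  have x: "coeff x l m = (if (l, m) \<in> ?A then 1 else 0)" for l m
    unfolding x_def using \<open>finite I\<close> by (subst coeff_unip) auto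
  \<comment> \<open>Injectivity of \<open>s\<close> leaves a single entry in row \<open>s i\<close>
    of \<open>x - 1\<close>, and injectivity of \<open>t\<close> a single one in column
    \<open>t j\<close>; the sums below therefore reduce to one term each.\<close>
  have row: "coeff x (s i) k = (if k = t i then 1 else 0)" for k
    using inj ij by (auto simp: x inj_on_def)
  have col: "coeff x k (t j) = (if k = s j then 1 else 0)" for k
    using inj ij by (auto simp: x inj_on_def)
  have "coeff (x \<circ> g) (s i) (t j) = coeff g (s i) (t j) + coeff x (s i) (t j) +
      (\<Sum>k\<in>{s j}. coeff g (s i) k * coeff x k (t j))"
    using linear_unip[of ?A "\<lambda>_ _. 1 :: 'f"]
    by (intro coeff_comp) (auto simp: col x_def[symmetric] split: if_splits)
  moreover have "coeff (g \<circ> x) (s i) (t j) = coeff x (s i) (t j) + coeff g (s i) (t j) +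
      (\<Sum>k\<in>{t i}. coeff x (s i) k * coeff g k (t j))"
    by (rule coeff_comp) (auto simp: row g split: if_splits)
  ultimately show ?thesis using comm by (simp add: row col)
qed

lemma pseudocentre_supp:
  fixes p q :: "'l::linorder"
  assumes inf: "infinite (UNIV :: 'l set)"
    and u: "u \<in> pseudocentre (McLain TYPE('f::field) ((<) :: 'l \<Rightarrow> 'l \<Rightarrow> bool))"
    and pq: "(p, q) \<in> supp u" "p < q"
  shows "infinite {p..q}"
proof
  assume fin: "finite {p..q}"
  let ?M = "McLain TYPE('f) ((<) :: 'l \<Rightarrow> 'l \<Rightarrow> bool)" and ?I = "{p..q}"
  have inj: "inj_on d ?I" if "strict_antimono_on ?I d" for d :: "'l \<Rightarrow> 'l"
    using that by (intro linorder_inj_onI) (force simp: monotone_on_def)+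
  \<comment> \<open>There is room above \<open>q\<close> or below \<open>p\<close>. The map on the
    side with room reverses the order and the other is \<open>id\<close>; naming them
    \<open>s\<close> and \<open>t\<close> lets one argument serve both cases.\<close>
  have "\<exists>s t. inj_on s ?I \<and> inj_on t ?I \<and> (\<forall>i\<in>?I. s i < t i) \<and>
      (strict_antimono_on ?I t \<and> s = id \<or> strict_antimono_on ?I s \<and> t = id)"
  proof (cases "infinite {q<..}")
    case True
    then obtain d where d: "strict_antimono_on ?I d" "d ` ?I \<subseteq> {q<..}"
      using ex_strict_antimono[OF fin] by blast
    then have "i < d i" if "i \<in> ?I" for i using that by fastforce
    then show ?thesis using d(1) inj[OF d(1)] by (intro exI[of _ id] exI[of _ d]) simp
  next
    case False
    have "UNIV = {..<p} \<union> {p..q} \<union> {q<..}" by auto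
    then have "infinite {..<p}" using False fin inf by (metis finite_UnI)
    then obtain d where d: "strict_antimono_on ?I d" "d ` ?I \<subseteq> {..<p}"
      using ex_strict_antimono[OF fin] by blast
    then have "d i < i" if "i \<in> ?I" for i using that by fastforce
    then show ?thesis using d(1) inj[OF d(1)] by (intro exI[of _ d] exI[of _ id]) simp
  qed
  then obtain s t where st: "inj_on s ?I" "inj_on t ?I" "\<forall>i\<in>?I. s i < t i"
    and anti: "strict_antimono_on ?I t \<and> s = id \<or> strict_antimono_on ?I s \<and> t = id"
    by blast
  define x where "x = unip ((\<lambda>i. (s i, t i)) ` ?I) (\<lambda>_ _. 1 :: 'f)"
  have x: "x \<in> carrier ?M"
    unfolding x_def using fin st(3) by (intro unip_in_McLain) auto
  let ?K = "{g \<in> carrier ?M. \<forall>l\<in>?I. \<forall>m\<in>?I. coeff g l m = 0}"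
  have "centralizer ?M x \<subseteq> ?K"
  proof
    fix g assume "g \<in> centralizer ?M x"
    then have g: "g \<in> carrier ?M" "g \<circ> x = x \<circ> g" by (auto simp: centralizer_def)
    have "coeff g l m = 0" if lm: "l \<in> ?I" "m \<in> ?I" for l m
    proof (cases "l < m")
      case True
      have "Vector_Spaces.linear vscale vscale g" using g(1) by (simp add: McLain_iff_supp)
      then have "coeff g (s l) (s m) = coeff g (t l) (t m)"
        by (rule coeff_eq_of_commute[OF fin st(1,2) _ g(2)[unfolded x_def] lm])
      \<comment> \<open>One of the two equal coefficients is \<open>coeff g l m\<close>; the other
        has its indices reversed, so it lies below the diagonal and vanishes.\<close>
      moreover have "t m < t l \<and> s = id \<or> s m < s l \<and> t = id"
        using anti monotone_onD[OF _ lm, of "(<)" "(>)"] True by blast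
      ultimately show ?thesis
        using McLain_coeff_less[OF g(1)] by (metis id_apply less_asym)
    next
      case False
      then show ?thesis using McLain_coeff_less[OF g(1)] by blast
    qed
    then show "g \<in> ?K" using g by blast
  qed
  \<comment> \<open>\<open>?K\<close> is normal and contains the centralizer of \<open>x\<close>,
    hence also its normal closure, in which \<open>u\<close> lies.\<close>
  then have "u \<in> ?K"
    using u x normal_block_kernel[OF fin] unfolding pseudocentre_def normal_closure_def by blast
  then show False using pq by (auto simp: supp_def)
qed

section \<open>The pseudocentre of the McLain group of a linear order\<close>

theorem theorem4p4:
  assumes "infinite (UNIV :: 'l::linorder set)"
  shows "(\<forall>(m :: nat) (\<alpha> :: nat \<Rightarrow> 'l) (\<beta> :: nat \<Rightarrow> 'l) (a :: nat \<Rightarrow> 'f::field) u.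
            u \<in> carrier (McLain TYPE('f) ((<) :: 'l \<Rightarrow> 'l \<Rightarrow> bool)) \<and>
            u = (\<lambda>x. x + (\<Sum>i\<in>{1..m}. vscale (a i) (e_map (\<alpha> i) (\<beta> i) x))) \<and>
            (\<forall>i\<in>{1..m}. \<alpha> i < \<beta> i \<and> a i \<noteq> 0) \<and>
            (\<forall>i\<in>{1..m}. \<forall>j\<in>{1..m}. i \<noteq> j \<longrightarrow> (\<alpha> i, \<beta> i) \<noteq> (\<alpha> j, \<beta> j)) \<longrightarrow>
            (u \<in> pseudocentre (McLain TYPE('f) ((<) :: 'l \<Rightarrow> 'l \<Rightarrow> bool)) \<longleftrightarrow>
             (\<forall>i\<in>{1..m}. infinite {\<alpha> i..\<beta> i}))) \<and>
         pseudocentre (McLain TYPE('f) ((<) :: 'l \<Rightarrow> 'l \<Rightarrow> bool)) =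
           carrier (McLain TYPE('f) (inf_less :: 'l \<Rightarrow> 'l \<Rightarrow> bool))"
proof
  let ?M = "McLain TYPE('f) ((<) :: 'l \<Rightarrow> 'l \<Rightarrow> bool)"
  \<comment> \<open>The second claim comes first, since it turns membership in the pseudocentre into
    a condition on \<open>supp u\<close>.\<close>
  show eq: "pseudocentre ?M = carrier (McLain TYPE('f) (inf_less :: 'l \<Rightarrow> 'l \<Rightarrow> bool))"
  proof
    show "pseudocentre ?M \<subseteq> carrier (McLain TYPE('f) (inf_less :: 'l \<Rightarrow> 'l \<Rightarrow> bool))"
    proof
      fix u assume u: "u \<in> pseudocentre ?M"
      have "group ?M" by (rule group_McLain) simp
      then have "u \<in> carrier ?M"
        using u subgroup.subset[OF group.subgroup_pseudocentre] by blast
      then have "Vector_Spaces.linear vscale vscale u" "finite (supp u)"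
        and "supp u \<subseteq> {(l, m). inf_less l m}"
        using pseudocentre_supp[OF assms u] by (auto simp: McLain_iff_supp inf_less_def)
      then show "u \<in> carrier (McLain TYPE('f) inf_less)"
        by (simp add: McLain_inf_less_iff)
    qed
  qed (rule McLain_inf_less_subset_pseudocentre)
  have main: "u \<in> pseudocentre ?M \<longleftrightarrow> (\<forall>i\<in>{1..m}. infinite {\<alpha> i..\<beta> i})"
    if uM: "u \<in> carrier ?M"
      and u: "u = (\<lambda>x. x + (\<Sum>i\<in>{1..m}. vscale (a i) (e_map (\<alpha> i) (\<beta> i) x)))"
      and ne: "\<forall>i\<in>{1..m}. \<alpha> i < \<beta> i \<and> a i \<noteq> 0"
      and dist: "\<forall>i\<in>{1..m}. \<forall>j\<in>{1..m}. i \<noteq> j \<longrightarrow> (\<alpha> i, \<beta> i) \<noteq> (\<alpha> j, \<beta> j)"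
    for m and \<alpha> \<beta> :: "nat \<Rightarrow> 'l" and a :: "nat \<Rightarrow> 'f" and u
  proof -
    have coeff: "coeff u l k = (\<Sum>i\<in>{1..m}. if l = \<alpha> i \<and> k = \<beta> i then a i else 0)" for l k
      by (auto simp: coeff_def u lookup_add lookup_sum_pm lookup_e_map lookup_vbasis
          intro!: sum.cong)
    have "coeff u (\<alpha> j) (\<beta> j) = a j" if j: "j \<in> {1..m}" for j
    proof -
      \<comment> \<open>As the pairs are distinct, no cancellation can occur and only the term with
        \<open>i = j\<close> survives.\<close>
      have "coeff u (\<alpha> j) (\<beta> j) = (\<Sum>i\<in>{1..m}. if i = j then a j else 0)"
        unfolding coeff
      proof (rule sum.cong)
        fix i assume "i \<in> {1..m}"
        then show "(if \<alpha> j = \<alpha> i \<and> \<beta> j = \<beta> i then a i else 0) = (if i = j then a j else 0)"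
          using bspec[OF bspec[OF dist] j, of i] by (cases "i = j") auto
      qed simp
      then show ?thesis using j by simp
    qed
    then have "(\<alpha> j, \<beta> j) \<in> supp u" if "j \<in> {1..m}" for j
      using ne that by (simp add: supp_def)
    moreover have "\<exists>i\<in>{1..m}. l = \<alpha> i \<and> k = \<beta> i" if "(l, k) \<in> supp u" for l k
    proof (rule ccontr)
      assume "\<not> ?thesis"
      then have "coeff u l k = 0" unfolding coeff by (intro sum.neutral) auto
      then show False using that by (simp add: supp_def)
    qed
    \<comment> \<open>The pairs in the given expression are exactly the support, so the intervals to
      be tested are determined by \<open>u\<close>.\<close>
    ultimately have supp: "supp u = (\<lambda>i. (\<alpha> i, \<beta> i)) ` {1..m}"
      by fast
    have "u \<in> pseudocentre ?M \<longleftrightarrow> supp u \<subseteq> {(l, k). inf_less l k}"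
      using uM by (simp add: eq McLain_iff_supp McLain_inf_less_iff)
    also have "\<dots> \<longleftrightarrow> (\<forall>i\<in>{1..m}. infinite {\<alpha> i..\<beta> i})"
      using ne by (auto simp: supp inf_less_def)
    finally show ?thesis .
  qed
  show "\<forall>(m :: nat) (\<alpha> :: nat \<Rightarrow> 'l) (\<beta> :: nat \<Rightarrow> 'l) (a :: nat \<Rightarrow> 'f::field) u.
      u \<in> carrier (McLain TYPE('f) ((<) :: 'l \<Rightarrow> 'l \<Rightarrow> bool)) \<and>
      u = (\<lambda>x. x + (\<Sum>i\<in>{1..m}. vscale (a i) (e_map (\<alpha> i) (\<beta> i) x))) \<and>
      (\<forall>i\<in>{1..m}. \<alpha> i < \<beta> i \<and> a i \<noteq> 0) \<and>
      (\<forall>i\<in>{1..m}. \<forall>j\<in>{1..m}. i \<noteq> j \<longrightarrow> (\<alpha> i, \<beta> i) \<noteq> (\<alpha> j, \<beta> j)) \<longrightarrow>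
      (u \<in> pseudocentre (McLain TYPE('f) ((<) :: 'l \<Rightarrow> 'l \<Rightarrow> bool)) \<longleftrightarrow>
       (\<forall>i\<in>{1..m}. infinite {\<alpha> i..\<beta> i}))"
    by (intro allI impI, elim conjE) (rule main)
qed

end
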